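(* Let $\Omega$, $a$, $n_1,n_2,n_3$, ${\bf e}$, $\sigma_1$, $\rho$, $P$, $\nu$, ${\bf m}$, $d$, $Q$, $\sigma_2$ be as in the setting described in the context. Suppose that the unit field ${\bf e}(x)=(e'(x),e_3(x))$ is in $C^2(\Omega)$ with $e'=\nabla h$ for some function $h$, and $e_3>0$. Assume moreover that ${\bf m}$ is in $C^2(\Omega)$. If $$\det\Big(D^2h+(1-\kappa_1{\bf e}\cdot{\bf m})D^2\rho-\kappa_1\big(D\rho\otimes({\bf m}D{\bf e})+({\bf m}D{\bf e})\otimes D\rho\big)-\kappa_1\rho\big(D({\bf m}D{\bf e})-D{\bf e}\otimes D{\bf m}\big)+\kappa_1 d\,D{\bf m}\otimes D{\bf m}\Big)\neq0$$ at $x_0\in\Omega$, then there exist a neighborhood $U\subseteq\Omega$ of $x_0$ and a $C^1$ tangential phase discontinuity $\phi$ defined in a neighborhood of $(Q(x_0),a)\in\sigma_2$ such that for every $x\in U$ the field ${\bf e}(x)$ is refracted by the lens $(\sigma_1,(\sigma_2,\phi))$ into the vertical direction ${\bf w}=(0,0,1)$.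
   Context: Notation. Vectors are row vectors. If $A$ is an $m\times n$ matrix and $B$ an $m\times p$ matrix, $A\otimes B=A^tB$. For ${\bf F}=(F_1,\dots,F_m)$ a $C^1$ field on an open subset of $\mathbb R^n$, $D{\bf F}=(\partial F_k/\partial x_i)_{1\le k\le m,1\le i\le n}$ ($m\times n$ matrix; for scalar $\rho$, $D\rho$ is the row gradient and $D^2\rho$ the Hessian). Thus ${\bf m}D{\bf e}$ is the row vector $({\bf m}\cdot{\bf e}_{x_1},{\bf m}\cdot{\bf e}_{x_2})$. Setting. $\Omega\subseteq\mathbb R^2$ is open and connected; $a>0$; $n_1,n_2,n_3>0$ are refractive indices of media I, II, III with $n_2>n_1$; $\kappa_1=n_2/n_1>1$, $\kappa_2=n_3/n_2$; $k>0$ is the wave number in medium II. ${\bf e}(x)=(e_1(x),e_2(x),e_3(x))=(e'(x),e_3(x))$ is a unit vector field on $\Omega$, $e'=(e_1,e_2)$. $\sigma_1$ is a $C^2$ surface contained in $\{0<x_3<a\}$, separating medium I (below) from medium II (between $\sigma_1$ and the plane $\{x_3=a\}$); medium III is above $\{x_3=a\}$. The ray issued from $(x,0)$, $x\in\Omega$, with direction ${\bf e}(x)$ strikes $\sigma_1$ at $P(x)=(x,0)+\rho(x){\bf e}(x)$, where $\rho(x)=|P(x)-(x,0)|>0$ and $\rho\in C^2(\Omega)$. $\nu=\nu(x)$ denotes the unit normal to $\sigma_1$ at $P(x)$ toward medium II; it is assumed that ${\bf e}(x)\cdot\nu\ge0$ and $\nu_3>0$. The refracted unit direction in medium II is, by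 Snell's law, $${\bf m}(x)=\frac1{\kappa_1}\left({\bf e}(x)-\lambda\nu\right)=(m_1(x),m_2(x),m_3(x)),\qquad \lambda={\bf e}(x)\cdot\nu-\sqrt{\kappa_1^2-1+({\bf e}(x)\cdot\nu)^2},$$ so that $m_3>0$. This ray meets the plane $\{x_3=a\}$ at $(Q(x),a)=P(x)+d(x){\bf m}(x)$, where $Q=(Q_1,Q_2)$ and $d(x)=\dfrac{a-\rho(x)e_3(x)}{m_3(x)}$. Put $\sigma_2=\{(Q(x),a):x\in\Omega\}$. Metasurface. A phase discontinuity is a $C^1$ real function $\phi(u_1,u_2,u_3)$ on an open set of $\mathbb R^3$; it is tangential (to $\sigma_2\subset\{x_3=a\}$) if $\nabla\phi\cdot(0,0,1)=0$ at the points of incidence $(Q(x),a)$. The lens $(\sigma_1,(\sigma_2,\phi))$ has lower face the refracting surface $\sigma_1$ and upper face the flat metasurface $(\sigma_2,\phi)$. It refracts ${\bf e}(x)$ into ${\bf w}=(0,0,1)$ if $\phi$ is defined near $(Q(x),a)$ and the generalized Snell law holds there with incident direction ${\bf m}(x)$, normal $(0,0,1)$ and refracted direction ${\bf w}$: $${\bf m}(x)-\tfrac1k\nabla\phi(Q(x),a)-\kappa_2{\bf w}=\mu\,(0,0,1),$$ where, with ${\bf q}={\bf m}(x)-\frac1k\nabla\phi(Q(x),a)$ and $q_3$ its third component, $\mu=q_3-\sqrt{\kappa_2^2-|{\bf q}|^2+q_3^2}$, and the quantity under the square root is required to be nonnegative. *)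

theory Defs
  imports "HOL-Analysis.Analysis"
begin

text \<open>C^1 and C^2 maps are meant for open \<open>S\<close> only, where \<open>at x\<close> is the full neighbourhood filter.\<close>

definition C1_on :: "('a::real_normed_vector \<Rightarrow> 'b::real_normed_vector) \<Rightarrow> 'a set \<Rightarrow> bool" where
  "C1_on f S \<longleftrightarrow>
    (\<exists>f' :: 'a \<Rightarrow> 'a \<Rightarrow>\<^sub>L 'b.
      (\<forall>x\<in>S. (f has_derivative blinfun_apply (f' x)) (at x)) \<and> continuous_on S f')"

definition C2_on :: "('a::real_normed_vector \<Rightarrow> 'b::real_normed_vector) \<Rightarrow> 'a set \<Rightarrow> bool" where
  "C2_on f S \<longleftrightarrow>
    (\<exists>f' :: 'a \<Rightarrow> 'a \<Rightarrow>\<^sub>L 'b.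
      (\<forall>x\<in>S. (f has_derivative blinfun_apply (f' x)) (at x)) \<and> C1_on f' S)"

text \<open>For a vector field, the matrix of partial derivatives (entry \<open>k, i\<close> equal to the derivative
  of the \<open>k\<close>-th component in direction \<open>i\<close>) is the library's \<open>jacobian\<close>.\<close>

definition grad :: "(real^'n \<Rightarrow> real) \<Rightarrow> real^'n \<Rightarrow> real^'n" where
  "grad f x = (\<chi> i. frechet_derivative f (at x) (axis i 1))"

definition hessian :: "(real^'n \<Rightarrow> real) \<Rightarrow> real^'n \<Rightarrow> real^'n^'n" where
  "hessian f x = jacobian (grad f) (at x)"

definition tprod :: "real^'n^'m \<Rightarrow> real^'p^'m \<Rightarrow> real^'p^'n"  (infixl \<open>\<otimes>\<^sub>t\<close> 70) where
  "A \<otimes>\<^sub>t B = transpose A ** B"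

abbreviation row_mat :: "real^'n \<Rightarrow> real^'n^1" where
  "row_mat v \<equiv> rowvector v"

definition hor :: "real^3 \<Rightarrow> real^2" where
  "hor v = vector [v $ 1, v $ 2]"

definition lift3 :: "real^2 \<Rightarrow> real \<Rightarrow> real^3" where
  "lift3 x t = vector [x $ 1, x $ 2, t]"

abbreviation vert :: "real^3" where
  "vert \<equiv> vector [0, 0, 1]"

definition C2_surface :: "(real^3) set \<Rightarrow> bool" where
  "C2_surface S \<longleftrightarrow>
    (\<forall>p\<in>S. \<exists>W G. open W \<and> p \<in> W \<and> C2_on G W \<and> (\<forall>q\<in>W. grad G q \<noteq> 0) \<and>
      S \<inter> W = {q \<in> W. G q = 0})"

definition tangent_vectors :: "(real^3) set \<Rightarrow> real^3 \<Rightarrow> (real^3) set" where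
  "tangent_vectors S p =
    {v. \<exists>\<gamma> \<epsilon>. 0 < \<epsilon> \<and> \<gamma> C1_differentiable_on {-\<epsilon><..<\<epsilon>} \<and> \<gamma> ` {-\<epsilon><..<\<epsilon>} \<subseteq> S \<and>
      \<gamma> 0 = p \<and> (\<gamma> has_vector_derivative v) (at 0)}"

definition unit_normal_toward :: "(real^3) set \<Rightarrow> (real^3) set \<Rightarrow> real^3 \<Rightarrow> real^3 \<Rightarrow> bool" where
  "unit_normal_toward S B p n \<longleftrightarrow>
    norm n = 1 \<and> (\<forall>v \<in> tangent_vectors S p. n \<bullet> v = 0) \<and>
    (\<exists>\<epsilon>>0. \<forall>t. 0 < t \<and> t < \<epsilon> \<longrightarrow> p + t *\<^sub>R n \<in> B)"

text \<open>Separation is local: the surface need not be closed nor a graph, and the media \<open>A\<close>, \<open>B\<close>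
  are only required to fill its two sides near each of its points.\<close>

definition separates :: "(real^3) set \<Rightarrow> (real^3) set \<Rightarrow> (real^3) set \<Rightarrow> bool" where
  "separates S A B \<longleftrightarrow>
    open A \<and> open B \<and> A \<inter> B = {} \<and> S \<inter> (A \<union> B) = {} \<and>
    (\<forall>p\<in>S. p \<in> closure A \<and> p \<in> closure B \<and> (\<exists>W. open W \<and> p \<in> W \<and> W - S \<subseteq> A \<union> B))"

text \<open>Snell's law at a surface with unit normal \<open>n\<close>, for incident unit direction \<open>u\<close> and relative
  refractive index \<open>\<kappa>\<close> (second medium over first).\<close>

definition snell_refract :: "real \<Rightarrow> real^3 \<Rightarrow> real^3 \<Rightarrow> real^3" where
  "snell_refract \<kappa> u n =
    (1 / \<kappa>) *\<^sub>R (u - (u \<bullet> n - sqrt (\<kappa>\<^sup>2 - 1 + (u \<bullet> n)\<^sup>2)) *\<^sub>R n)"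

text \<open>Generalized Snell law at the point \<open>p\<close> of a horizontal metasurface whose phase discontinuity
  \<open>\<phi>\<close> is defined on the open set \<open>V\<close>: incident direction \<open>m\<close>, refracted direction \<open>w\<close>,
  wave number \<open>k\<close>. The sign condition is needed because \<open>sqrt\<close> is total.\<close>

definition metasurface_refracts ::
    "real \<Rightarrow> real \<Rightarrow> (real^3) set \<Rightarrow> (real^3 \<Rightarrow> real) \<Rightarrow> real^3 \<Rightarrow> real^3 \<Rightarrow> real^3 \<Rightarrow> bool" where
  "metasurface_refracts k \<kappa> V \<phi> p m w \<longleftrightarrow>
    p \<in> V \<and>
    (let q = m - (1 / k) *\<^sub>R grad \<phi> p;
         r = \<kappa>\<^sup>2 - (norm q)\<^sup>2 + (q $ 3)\<^sup>2;
         \<mu> = q $ 3 - sqrt r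
     in 0 \<le> r \<and> q - \<kappa> *\<^sub>R w = \<mu> *\<^sub>R vert)"

definition tangential_phase :: "(real^3) set \<Rightarrow> (real^3) set \<Rightarrow> (real^3 \<Rightarrow> real) \<Rightarrow> bool" where
  "tangential_phase \<sigma> V \<phi> \<longleftrightarrow> (\<forall>p \<in> \<sigma> \<inter> V. grad \<phi> p \<bullet> vert = 0)"

end

theory Submission
  imports Defs
begin

text \<open>
  The ray leaves the metasurface vertically as soon as the gradient of the phase at \<open>(Q x, a)\<close> is
  \<open>k (m\<^sub>1, m\<^sub>2, 0)\<close>. Such a phase exists near \<open>Q x0\<close> once \<open>DQ\<close> is invertible there, because the
  optical path \<open>\<Psi> = (h + \<rho>) / \<kappa>\<^sub>1 + d\<close> satisfies \<open>D\<Psi> = (m\<^sub>1, m\<^sub>2) DQ\<close>: by Snell's law \<open>e - \<kappa>\<^sub>1 m\<close>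
  is normal to \<open>\<sigma>\<^sub>1\<close>, so \<open>\<kappa>\<^sub>1 m \<cdot> DP = e \<cdot> DP = D(h + \<rho>)\<close>, while \<open>m \<cdot> Dm = 0\<close>. Differentiating
  \<open>\<kappa>\<^sub>1 m \<cdot> DP = D(h + \<rho>)\<close> once more shows that the matrix of the hypothesis is \<open>\<kappa>\<^sub>1\<close> times the
  transpose of \<open>D(Q, a)\<close> times \<open>Dm\<close>; since it is nonsingular, \<open>DQ\<close> is injective.
\<close>

section \<open>Projection to the horizontal plane and lifting back to space\<close>

lemma hor_nth [simp]: "hor v $ 1 = v $ 1" "hor v $ 2 = v $ 2"
  by (simp_all add: hor_def)

lemma lift3_nth [simp]: "lift3 x t $ 1 = x $ 1" "lift3 x t $ 2 = x $ 2" "lift3 x t $ 3 = t"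
  by (simp_all add: lift3_def)

lemma hor_lift3 [simp]: "hor (lift3 x t) = x"
  by (simp add: vec_eq_iff forall_2)

lemma bounded_linear_hor: "bounded_linear hor"
  unfolding linear_conv_bounded_linear [symmetric]
  by (rule linearI) (simp_all add: vec_eq_iff forall_2)

lemma bounded_linear_lift3_0: "bounded_linear (\<lambda>x. lift3 x 0)"
  unfolding linear_conv_bounded_linear [symmetric]
  by (rule linearI) (simp_all add: vec_eq_iff forall_3)

text \<open>Adjointness of \<open>hor\<close> and the lift at height 0, which moves pairings between
  the parameter plane and space.\<close>

lemma inner_hor: "hor p \<bullet> x = p \<bullet> lift3 x 0"
  by (simp add: inner_vec_def sum_2 sum_3)

lemma inner_vert: "p \<bullet> vert = p $ 3"
  by (simp add: inner_vec_def sum_3)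

section \<open>Gradients, Jacobians and matrix products as linear and bilinear forms\<close>

lemma grad_eqI:
  assumes "(f has_derivative (\<lambda>v. g \<bullet> v)) (at x)"
  shows "grad f x = g"
  unfolding grad_def frechet_derivative_at [OF assms, symmetric]
  by (simp add: vec_eq_iff inner_axis)

lemma inner_grad:
  assumes "(f has_derivative D) (at x)"
  shows "grad f x \<bullet> v = D v"
proof -
  have "linear D" using assms by (rule has_derivative_linear)
  have "grad f x \<bullet> v = (\<Sum>i\<in>UNIV. v $ i *\<^sub>R D (axis i 1))"
    by (simp add: grad_def frechet_derivative_at [OF assms, symmetric] inner_vec_def mult.commute)
  also have "\<dots> = D (\<Sum>i\<in>UNIV. v $ i *\<^sub>R axis i 1)"
    using \<open>linear D\<close> by (simp add: linear_sum linear_cmul)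
  also have "(\<Sum>i\<in>UNIV. v $ i *\<^sub>R axis i 1) = v"
    by (simp add: vec_eq_iff axis_def if_distrib cong: if_cong)
  finally show ?thesis .
qed

lemma jacobian_mult_vec:
  fixes f :: "real^'n \<Rightarrow> real^'m"
  assumes "(f has_derivative D) (at x)"
  shows "jacobian f (at x) *v v = D v"
proof -
  have "f differentiable (at x)" using assms unfolding differentiable_def by blast
  then have "(f has_derivative (\<lambda>v. jacobian f (at x) *v v)) (at x)"
    by (simp add: jacobian_works)
  from has_derivative_unique [OF this assms] show ?thesis by (rule fun_cong)
qed

text \<open>Several terms of the matrix in the hypothesis are such products. Read as bilinear forms,
  they can be computed on a pair of vectors instead of entry by entry.\<close>

lemma inner_tprod_mult_vec: "v \<bullet> ((A \<otimes>\<^sub>t B) *v w) = (A *v v) \<bullet> (B *v w)"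
  for v :: "real^'n" and A :: "real^'n^'m"
  by (simp add: tprod_def flip: matrix_vector_mul_assoc)
     (metis dot_lmul_matrix transpose_transpose vector_transpose_matrix inner_commute)

lemma inner_row_mat_mult_vec: "(row_mat b *v v) \<bullet> (row_mat c *v w) = (b \<bullet> v) * (c \<bullet> w)"
  by (simp add: inner_vec_def rowvector_def matrix_vector_mult_def)

section \<open>Calculus of C1 and C2 maps\<close>

text \<open>Differentiability into a Euclidean space is componentwise. The formula for the pairings
  is available only on \<open>S\<close>, and openness of \<open>S\<close> makes that enough at
  \<open>x\<close>.\<close>

lemma differentiable_of_inner_on:
  fixes f :: "'a::real_normed_vector \<Rightarrow> 'b::euclidean_space"
  assumes "open S" "x \<in> S" "\<And>y v. y \<in> S \<Longrightarrow> f y \<bullet> v = F y v"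
    and F: "\<And>v. (\<lambda>y. F y v) differentiable (at x)"
  shows "f differentiable (at x)"
proof (rule differentiable_componentwise_within [THEN iffD2], rule ballI)
  fix v :: 'b
  obtain G where G: "((\<lambda>y. F y v) has_derivative G) (at x)"
    using F unfolding differentiable_def by blast
  have "((\<lambda>y. f y \<bullet> v) has_derivative G) (at x)"
    by (rule has_derivative_transform_within_open [OF G assms(1,2)]) (simp add: assms(3))
  then show "(\<lambda>y. f y \<bullet> v) differentiable (at x)"
    unfolding differentiable_def by blast
qed

text \<open>On a finite-dimensional domain, continuity of the derivative on each fixed vector
  already gives continuity in operator norm. Derivatives can thus be handled as plain functions
  \<open>D x\<close>.\<close>

lemma C1_onI:
  fixes f :: "'a::euclidean_space \<Rightarrow> 'b::real_normed_vector"
  assumes der: "\<And>x. x \<in> S \<Longrightarrow> (f has_derivative D x) (at x)"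
    and cont: "\<And>v. continuous_on S (\<lambda>x. D x v)"
  shows "C1_on f S"
proof -
  have D: "blinfun_apply (Blinfun (D x)) = D x" if "x \<in> S" for x
    using der [OF that] has_derivative_bounded_linear bounded_linear_Blinfun_apply by blast
  have "continuous_on S (\<lambda>x. Blinfun (D x))"
  proof (rule continuous_on_blinfun_componentwise)
    fix i :: 'a
    show "continuous_on S (\<lambda>x. blinfun_apply (Blinfun (D x)) i)"
      using cont [of i] by (rule continuous_on_eq) (simp add: D)
  qed
  then show ?thesis
    unfolding C1_on_def using der D by (intro exI [of _ "\<lambda>x. Blinfun (D x)"]) simp
qed

lemma C1_on_has_derivative:
  assumes "C1_on f S" "x \<in> S"
  shows "(f has_derivative frechet_derivative f (at x)) (at x)"
  using assms unfolding C1_on_def frechet_derivative_works [symmetric] differentiable_def by blast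

lemma C1_on_continuous_derivative:
  assumes "C1_on f S"
  shows "continuous_on S (\<lambda>x. frechet_derivative f (at x) v)"
proof -
  obtain f' where f': "\<forall>x\<in>S. (f has_derivative blinfun_apply (f' x)) (at x)"
    "continuous_on S f'"
    using assms unfolding C1_on_def by blast
  have "continuous_on S (\<lambda>x. blinfun_apply (f' x) v)"
    using f'(2) by (intro continuous_intros)
  then show ?thesis
    by (rule continuous_on_eq) (simp add: frechet_derivative_at [OF f'(1) [rule_format], symmetric])
qed

lemma C1_on_imp_continuous_on:
  assumes "C1_on f S"
  shows "continuous_on S f"
  using C1_on_has_derivative [OF assms]
  by (intro continuous_at_imp_continuous_on) (blast intro: has_derivative_continuous)

lemma C2_on_has_derivative:
  assumes "C2_on f S" "x \<in> S"
  shows "(f has_derivative frechet_derivative f (at x)) (at x)"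
  using assms unfolding C2_on_def frechet_derivative_works [symmetric] differentiable_def by blast

text \<open>Evaluation at \<open>v\<close> is bounded linear on the space of operators, so it
  preserves the differentiability of the derivative map.\<close>

lemma C2_on_differentiable_derivative:
  assumes "open S" "C2_on f S" "x \<in> S"
  shows "(\<lambda>y. frechet_derivative f (at y) v) differentiable (at x)"
proof -
  obtain f' where f': "\<forall>x\<in>S. (f has_derivative blinfun_apply (f' x)) (at x)" "C1_on f' S"
    using assms(2) unfolding C2_on_def by blast
  have "((\<lambda>y. blinfun_apply (f' y) v) has_derivative
      (\<lambda>w. blinfun_apply (frechet_derivative f' (at x) w) v)) (at x)"
    by (rule bounded_linear.has_derivative [OF blinfun.bounded_linear_left
          C1_on_has_derivative [OF f'(2) assms(3)]])
  then have "((\<lambda>y. frechet_derivative f (at y) v) has_derivative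
      (\<lambda>w. blinfun_apply (frechet_derivative f' (at x) w) v)) (at x)"
    by (rule has_derivative_transform_within_open [OF _ assms(1,3)])
       (simp add: frechet_derivative_at [OF f'(1) [rule_format], symmetric])
  then show ?thesis unfolding differentiable_def by blast
qed

lemma C2_on_imp_C1_on:
  fixes f :: "'a::euclidean_space \<Rightarrow> 'b::real_normed_vector"
  assumes "open S" "C2_on f S"
  shows "C1_on f S"
  using C2_on_has_derivative [OF assms(2)]
proof (rule C1_onI)
  show "continuous_on S (\<lambda>x. frechet_derivative f (at x) v)" for v
    using C2_on_differentiable_derivative [OF assms]
    by (intro continuous_at_imp_continuous_on) (blast intro: differentiable_imp_continuous_within)
qed

lemma C1_on_cong:
  assumes "open S" "\<And>x. x \<in> S \<Longrightarrow> f x = g x" "C1_on g S"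
  shows "C1_on f S"
proof -
  obtain g' where g': "\<forall>x\<in>S. (g has_derivative blinfun_apply (g' x)) (at x)" "continuous_on S g'"
    using assms(3) unfolding C1_on_def by blast
  have "(f has_derivative blinfun_apply (g' x)) (at x)" if "x \<in> S" for x
    by (rule has_derivative_transform_within_open [OF g'(1) [rule_format, OF that] assms(1) that])
       (simp add: assms(2))
  with g'(2) show ?thesis unfolding C1_on_def by blast
qed

lemma C1_on_add:
  fixes f g :: "'a::euclidean_space \<Rightarrow> 'b::real_normed_vector"
  assumes "C1_on f S" "C1_on g S"
  shows "C1_on (\<lambda>x. f x + g x) S"
  by (rule C1_onI [OF has_derivative_add [OF assms [THEN C1_on_has_derivative]]])
     (auto intro!: continuous_intros assms C1_on_continuous_derivative)

lemma C1_on_scaleR: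
  fixes f :: "'a::euclidean_space \<Rightarrow> real" and g :: "'a \<Rightarrow> 'b::real_normed_vector"
  assumes "C1_on f S" "C1_on g S"
  shows "C1_on (\<lambda>x. f x *\<^sub>R g x) S"
  by (rule C1_onI [OF has_derivative_scaleR [OF assms [THEN C1_on_has_derivative]]])
     (auto intro!: continuous_intros assms assms [THEN C1_on_imp_continuous_on]
       C1_on_continuous_derivative)

lemma C1_on_divide:
  fixes f g :: "'a::euclidean_space \<Rightarrow> real"
  assumes "C1_on f S" "C1_on g S" "\<And>x. x \<in> S \<Longrightarrow> g x \<noteq> 0"
  shows "C1_on (\<lambda>x. f x / g x) S"
  by (rule C1_onI [OF has_derivative_divide' [OF assms(1,2) [THEN C1_on_has_derivative]]])
     (auto intro!: continuous_intros assms(1,2) assms(1,2) [THEN C1_on_imp_continuous_on]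
       C1_on_continuous_derivative
       dest: assms(3))

lemma C1_on_bounded_linear:
  fixes f :: "'a::euclidean_space \<Rightarrow> 'b::real_normed_vector"
  assumes "bounded_linear L" "C1_on f S"
  shows "C1_on (\<lambda>x. L (f x)) S"
  by (rule C1_onI [OF bounded_linear.has_derivative [OF assms(1) C1_on_has_derivative [OF assms(2)]]])
     (auto intro!: bounded_linear.continuous_on [OF assms(1)] assms C1_on_continuous_derivative)

lemma C1_on_const: "C1_on (\<lambda>x. c) (S :: 'a::euclidean_space set)"
  by (rule C1_onI [where D = "\<lambda>x v. 0"]) auto

lemma C1_on_ident: "C1_on (\<lambda>x. x) (S :: 'a::euclidean_space set)"
  by (rule C1_onI [where D = "\<lambda>x v. v"]) auto

section \<open>Tangent vectors and unit fields\<close>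

text \<open>The image under \<open>f\<close> of a short segment through \<open>x\<close> in
  direction \<open>v\<close> is a C1 curve in \<open>T\<close> whose velocity at time 0 is
  \<open>D v\<close>.\<close>

lemma derivative_in_tangent_vectors:
  fixes f :: "'a::euclidean_space \<Rightarrow> real^3"
  assumes "open S" "C1_on f S" "f ` S \<subseteq> T" "x \<in> S" "(f has_derivative D) (at x)"
  shows "D v \<in> tangent_vectors T (f x)"
proof -
  define F where "F x = frechet_derivative f (at x)" for x
  have F: "(f has_derivative F x) (at x)" "continuous_on S (\<lambda>x. F x v)" if "x \<in> S" for x v
    unfolding F_def using assms(2) that
    by (rule C1_on_has_derivative, intro C1_on_continuous_derivative)
  define l where "l = (\<lambda>t::real. x + t *\<^sub>R v)"
  have "open (l -` S)"
    unfolding l_def using \<open>open S\<close> by (intro open_vimage continuous_intros)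
  moreover have "0 \<in> l -` S" using \<open>x \<in> S\<close> by (simp add: l_def)
  ultimately obtain \<epsilon> where \<epsilon>: "\<epsilon> > 0" "ball 0 \<epsilon> \<subseteq> l -` S"
    unfolding open_contains_ball by blast
  have l: "l t \<in> S" if "t \<in> {-\<epsilon><..<\<epsilon>}" for t
    using that \<epsilon>(2) by (force simp: dist_real_def)
  have der: "((\<lambda>t. f (l t)) has_vector_derivative F (l t) v) (at t)" if "t \<in> {-\<epsilon><..<\<epsilon>}" for t
  proof -
    have "(l has_derivative (\<lambda>s. s *\<^sub>R v)) (at t)"
      unfolding l_def by (auto intro!: derivative_eq_intros)
    from has_derivative_compose [OF this F(1) [OF l [OF that]]]
    have "((\<lambda>t. f (l t)) has_derivative (\<lambda>s. F (l t) (s *\<^sub>R v))) (at t)" .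
    moreover have "F (l t) (s *\<^sub>R v) = s *\<^sub>R F (l t) v" for s
      using F(1) [OF l [OF that]] by (simp add: has_derivative_linear linear_cmul)
    ultimately show ?thesis by (simp add: has_vector_derivative_def)
  qed
  have "continuous_on {-\<epsilon><..<\<epsilon>} (\<lambda>t. F (l t) v)"
    by (rule continuous_on_compose2 [OF F(2) [OF \<open>x \<in> S\<close>]])
       (auto simp: l_def intro!: continuous_intros l [unfolded l_def])
  then have "(\<lambda>t. f (l t)) C1_differentiable_on {-\<epsilon><..<\<epsilon>}"
    unfolding C1_differentiable_on_def using der
    by (intro exI [of _ "\<lambda>t. F (l t) v"] conjI ballI)
  moreover have "F x = D"
    using F(1) [OF \<open>x \<in> S\<close>] assms(5) by (rule has_derivative_unique)
  then have "((\<lambda>t. f (l t)) has_vector_derivative D v) (at 0)"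
    using der [of 0] \<epsilon>(1) by (simp add: l_def)
  moreover have "(\<lambda>t. f (l t)) ` {-\<epsilon><..<\<epsilon>} \<subseteq> T" "f (l 0) = f x"
    using l assms(3) by (auto simp: l_def)
  ultimately show ?thesis
    unfolding tangent_vectors_def using \<epsilon>(1)
    by (intro CollectI exI [of _ "\<lambda>t. f (l t)"] exI [of _ \<epsilon>] conjI)
qed

text \<open>Differentiate the constant \<open>f y \<bullet> f y = 1\<close>.\<close>

lemma inner_derivative_unit_field:
  fixes f :: "'a::real_normed_vector \<Rightarrow> 'b::real_inner"
  assumes "open S" "\<And>y. y \<in> S \<Longrightarrow> norm (f y) = 1" "x \<in> S" "(f has_derivative D) (at x)"
  shows "f x \<bullet> D v = 0"
proof -
  have "((\<lambda>y. f y \<bullet> f y) has_derivative (\<lambda>v. f x \<bullet> D v + D v \<bullet> f x)) (at x)"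
    using assms(4) by (intro has_derivative_inner)
  moreover have "((\<lambda>y. f y \<bullet> f y) has_derivative (\<lambda>v. 0)) (at x)"
    by (rule has_derivative_transform_within_open [OF has_derivative_const [of 1] assms(1,3)])
       (simp add: assms(2) flip: power2_norm_eq_inner)
  ultimately have "(\<lambda>v. f x \<bullet> D v + D v \<bullet> f x) = (\<lambda>v. 0)"
    by (rule has_derivative_unique)
  from fun_cong [OF this, of v] show ?thesis by (simp add: inner_commute)
qed

section \<open>Snell's law at the lower face\<close>

text \<open>With \<open>c = u \<bullet> n\<close> and \<open>s\<close> the square root, the vector
  before scaling has squared norm \<open>1 - c * c + s * s\<close>, and \<open>s\<close> is chosen
  to make this the square of \<open>\<kappa>\<close>.\<close>

lemma norm_snell_refract:
  assumes "\<kappa> \<ge> 1" "norm u = 1" "norm n = 1"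
  shows "norm (snell_refract \<kappa> u n) = 1"
proof -
  define c where "c = u \<bullet> n"
  define s where "s = sqrt (\<kappa>\<^sup>2 - 1 + c\<^sup>2)"
  have "\<kappa>\<^sup>2 \<ge> 1" using assms(1) by simp
  then have s: "s * s = \<kappa>\<^sup>2 - 1 + c\<^sup>2" by (simp add: s_def flip: power2_eq_square)
  have "u \<bullet> u = 1" "n \<bullet> n = 1" using assms(2,3) by (simp_all add: dot_square_norm)
  then have "(norm (u - (c - s) *\<^sub>R n))\<^sup>2 = 1 - 2 * (c - s) * c + (c - s)\<^sup>2"
    unfolding power2_norm_eq_inner
    by (simp add: inner_diff_left inner_diff_right inner_commute [of n u] flip: c_def)
       (simp add: algebra_simps power2_eq_square)
  also have "\<dots> = \<kappa>\<^sup>2" using s by (simp add: algebra_simps power2_eq_square)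
  finally have "norm (u - (c - s) *\<^sub>R n) = \<kappa>"
    using assms(1) by (simp add: power2_eq_iff_nonneg)
  then show ?thesis
    using assms(1) by (simp add: snell_refract_def c_def [symmetric] s_def [symmetric])
qed

text \<open>For \<open>\<kappa> > 1\<close> the square root exceeds \<open>u \<bullet> n\<close>, so
  refraction adds a positive multiple of \<open>n\<close> to \<open>u\<close> before
  scaling.\<close>

lemma snell_refract_nth_pos:
  assumes "\<kappa> > 1" "u $ i > 0" "n $ i > 0"
  shows "snell_refract \<kappa> u n $ i > 0"
proof -
  have "\<kappa>\<^sup>2 > 1" using assms(1) by (simp add: one_less_power)
  then have "\<bar>u \<bullet> n\<bar> < sqrt (\<kappa>\<^sup>2 - 1 + (u \<bullet> n)\<^sup>2)"
    by (intro real_less_rsqrt) simp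
  then have "(u \<bullet> n - sqrt (\<kappa>\<^sup>2 - 1 + (u \<bullet> n)\<^sup>2)) * n $ i < 0"
    using assms(3) by (intro mult_neg_pos) auto
  then show ?thesis using assms(1,2) by (simp add: snell_refract_def)
qed

text \<open>Refraction changes \<open>u\<close> only along \<open>n\<close>, up to the factor
  \<open>1 / \<kappa>\<close>, and a tangent vector does not see that change.\<close>

lemma snell_refract_tangential:
  assumes "\<kappa> \<noteq> 0" "n \<bullet> v = 0"
  shows "\<kappa> * (snell_refract \<kappa> u n \<bullet> v) = u \<bullet> v"
  using assms by (simp add: snell_refract_def inner_diff_left)

section \<open>The phase discontinuity on the upper face\<close>

text \<open>Here \<open>q\<close> is \<open>m $ 3\<close> times \<open>vert\<close>, so the radicand
  is the square of \<open>\<kappa>\<close>. It is nonnegative and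
  \<open>\<mu> = m $ 3 - \<kappa>\<close>, as the law requires.\<close>

lemma vertical_refraction_of_grad:
  assumes "\<kappa> > 0" "k \<noteq> 0" "p \<in> V" "grad \<phi> p = k *\<^sub>R lift3 (hor m) 0"
  shows "metasurface_refracts k \<kappa> V \<phi> p m vert"
proof -
  have "m - lift3 (hor m) 0 = (m $ 3) *\<^sub>R vert"
    by (simp add: vec_eq_iff forall_3)
  moreover have "norm vert = 1" by (simp add: norm_eq_1 inner_vert)
  ultimately show ?thesis
    using assms by (simp add: metasurface_refracts_def Let_def scaleR_diff_left)
qed

text \<open>The phase is \<open>k \<Psi> \<circ> Q\<^sup>-\<^sup>1\<close>, extended constantly in the vertical direction.\<close>

lemma phase_of_potential:
  fixes Q :: "real^2 \<Rightarrow> real^2" and \<Psi> :: "real^2 \<Rightarrow> real"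
  assumes "open \<Omega>" "x0 \<in> \<Omega>" "C1_on Q \<Omega>" "continuous_on \<Omega> F"
    and inj: "\<And>D. (Q has_derivative D) (at x0) \<Longrightarrow> inj D"
    and pot: "\<And>x D. x \<in> \<Omega> \<Longrightarrow> (Q has_derivative D) (at x) \<Longrightarrow>
      (\<Psi> has_derivative (\<lambda>v. F x \<bullet> D v)) (at x)"
  obtains U V \<phi> where "open U" "x0 \<in> U" "U \<subseteq> \<Omega>" "open V" "C1_on \<phi> V"
    "\<forall>x\<in>U. \<forall>a. lift3 (Q x) a \<in> V \<and> grad \<phi> (lift3 (Q x) a) = k *\<^sub>R lift3 (F x) 0"
    "\<forall>p\<in>V. grad \<phi> p $ 3 = 0"
proof -
  obtain Q' where Q': "\<And>x. x \<in> \<Omega> \<Longrightarrow> (Q has_derivative blinfun_apply (Q' x)) (at x)"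
    "continuous_on \<Omega> Q'"
    using \<open>C1_on Q \<Omega>\<close> unfolding C1_on_def by blast
  \<comment> \<open>Injectivity provides a linear left inverse \<open>L\<close>, the form in which
    the inverse function theorem receives invertibility of the derivative.\<close>
  have "linear (blinfun_apply (Q' x0))" by (simp add: bounded_linear.linear blinfun.bounded_linear_right)
  then obtain L where L: "linear L" "L \<circ> blinfun_apply (Q' x0) = id"
    using linear_injective_left_inverse inj [OF Q'(1) [OF \<open>x0 \<in> \<Omega>\<close>]] by blast
  then have "Blinfun L o\<^sub>L Q' x0 = id_blinfun"
    by (intro blinfun_eqI)
       (simp add: bounded_linear_Blinfun_apply linear_conv_bounded_linear fun_eq_iff)
  from inverse_function_theorem [OF \<open>open \<Omega>\<close> Q' \<open>x0 \<in> \<Omega>\<close> this]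
  obtain U W g g' where U: "open U" "U \<subseteq> \<Omega>" "x0 \<in> U" and W: "open W" "homeomorphism U W Q g"
    and g: "\<And>y. y \<in> W \<Longrightarrow> (g has_derivative (g' y)) (at y)"
      "\<And>y. y \<in> W \<Longrightarrow> g' y = inv (blinfun_apply (Q' (g y)))"
      "\<And>y. y \<in> W \<Longrightarrow> bij (blinfun_apply (Q' (g y)))"
    by metis
  have gU: "g y \<in> U" if "y \<in> W" for y
    using W(2) that by (auto simp: homeomorphism_def)
  have QW: "Q x \<in> W" "g (Q x) = x" if "x \<in> U" for x
    using W(2) that by (auto simp: homeomorphism_def)
  have der: "((\<lambda>y. \<Psi> (g y)) has_derivative (\<lambda>v. F (g y) \<bullet> v)) (at y)" if "y \<in> W" for y
  proof -
    have "g y \<in> \<Omega>" using gU [OF that] U(2) by blast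
    \<comment> \<open>The chain rule leaves \<open>F (g y)\<close> paired with
      \<open>Q' (g y)\<close> applied to \<open>g' y v\<close>. By surjectivity \<open>inv\<close>
      is a right inverse, and that vector is \<open>v\<close>.\<close>
    from has_derivative_compose [OF g(1) [OF that] pot [OF this Q'(1) [OF this]]]
    show ?thesis
      using bij_is_surj [OF g(3) [OF that]] by (simp add: g(2) [OF that] surj_f_inv_f)
  qed
  define V where "V = hor -` W"
  define \<phi> where "\<phi> = (\<lambda>p. k * \<Psi> (g (hor p)))"
  have der\<phi>: "(\<phi> has_derivative (\<lambda>v. (k *\<^sub>R lift3 (F (g (hor p))) 0) \<bullet> v)) (at p)" if "p \<in> V" for p
  proof -
    have "hor p \<in> W" using that by (simp add: V_def)
    from has_derivative_compose [OF bounded_linear_imp_has_derivative [OF bounded_linear_hor]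
        der [OF this]]
    have "((\<lambda>p. \<Psi> (g (hor p))) has_derivative (\<lambda>v. F (g (hor p)) \<bullet> hor v)) (at p)" .
    then have "(\<phi> has_derivative (\<lambda>v. k * (F (g (hor p)) \<bullet> hor v))) (at p)"
      unfolding \<phi>_def by (rule has_derivative_mult_right)
    then show ?thesis
      by (simp add: inner_commute [of "lift3 _ _"] inner_commute [of "F _"] inner_hor)
  qed
  have grad: "grad \<phi> p = k *\<^sub>R lift3 (F (g (hor p))) 0" if "p \<in> V" for p
    by (rule grad_eqI [OF der\<phi> [OF that]])
  show thesis
  proof (rule that [of U V \<phi>])
    show "open V"
      unfolding V_def using W(1) bounded_linear_hor
      by (intro open_vimage linear_continuous_on)
    \<comment> \<open>The gradient of \<open>\<phi>\<close> is built from
      \<open>F (g (hor p))\<close>, so continuity of \<open>F\<close>, \<open>g\<close> and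
      \<open>hor\<close> makes the phase C1.\<close>
    have "continuous_on V hor"
      using bounded_linear_hor by (rule linear_continuous_on)
    moreover have "continuous_on W g" using W(2) by (simp add: homeomorphism_def)
    ultimately have "continuous_on V (\<lambda>p. g (hor p))"
      using continuous_on_compose2 [of W g V hor] by (auto simp: V_def)
    then have "continuous_on V (\<lambda>p. F (g (hor p)))"
      by (rule continuous_on_compose2 [OF assms(4)]) (use gU U(2) in \<open>auto simp: V_def\<close>)
    then have "continuous_on V (\<lambda>p. k *\<^sub>R lift3 (F (g (hor p))) 0)"
      by (intro continuous_intros bounded_linear.continuous_on [OF bounded_linear_lift3_0])
    then show "C1_on \<phi> V"
      by (intro C1_onI [OF der\<phi>] continuous_on_inner continuous_on_const)
  qed (use U QW grad in \<open>auto simp: V_def\<close>)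
qed

theorem theorem3p4:
  fixes \<Omega> :: "(real^2) set"
    and a n1 n2 n3 \<kappa>1 \<kappa>2 k :: real
    and e \<nu> P m :: "real^2 \<Rightarrow> real^3"
    and \<rho> d h :: "real^2 \<Rightarrow> real"
    and Q mDe :: "real^2 \<Rightarrow> real^2"
    and \<sigma>1 \<sigma>2 medI medII :: "(real^3) set"
    and x0 :: "real^2"
  assumes "open \<Omega>" and "connected \<Omega>"
    and "a > 0" and "n1 > 0" and "n2 > 0" and "n3 > 0" and "n2 > n1" and "k > 0"
    and "\<kappa>1 = n2 / n1" and "\<kappa>2 = n3 / n2"
    and "\<And>x. x \<in> \<Omega> \<Longrightarrow> norm (e x) = 1"
    and "C2_surface \<sigma>1" and "\<sigma>1 \<subseteq> {p. 0 < p $ 3 \<and> p $ 3 < a}"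
    and "separates \<sigma>1 medI medII"
    and "medI \<subseteq> {p. p $ 3 < a}" and "medII \<subseteq> {p. 0 < p $ 3 \<and> p $ 3 < a}"
    and "C2_on \<rho> \<Omega>" and "\<And>x. x \<in> \<Omega> \<Longrightarrow> \<rho> x > 0"
    and "\<And>x. x \<in> \<Omega> \<Longrightarrow> P x = lift3 x 0 + \<rho> x *\<^sub>R e x"
    and "\<And>x. x \<in> \<Omega> \<Longrightarrow> P x \<in> \<sigma>1"
    and "\<And>x t. x \<in> \<Omega> \<Longrightarrow> 0 < t \<Longrightarrow> t < \<rho> x \<Longrightarrow> lift3 x 0 + t *\<^sub>R e x \<notin> \<sigma>1"
    and "\<And>x. x \<in> \<Omega> \<Longrightarrow> unit_normal_toward \<sigma>1 medII (P x) (\<nu> x)"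
    and "\<And>x. x \<in> \<Omega> \<Longrightarrow> e x \<bullet> \<nu> x \<ge> 0" and "\<And>x. x \<in> \<Omega> \<Longrightarrow> \<nu> x $ 3 > 0"
    and "\<And>x. x \<in> \<Omega> \<Longrightarrow> m x = snell_refract \<kappa>1 (e x) (\<nu> x)"
    and "\<And>x. x \<in> \<Omega> \<Longrightarrow> d x = (a - \<rho> x * e x $ 3) / m x $ 3"
    and "\<And>x. x \<in> \<Omega> \<Longrightarrow> lift3 (Q x) a = P x + d x *\<^sub>R m x"
    and "\<sigma>2 = (\<lambda>x. lift3 (Q x) a) ` \<Omega>"
    and "C2_on e \<Omega>" and "\<And>x. x \<in> \<Omega> \<Longrightarrow> GDERIV h x :> hor (e x)"
    and "\<And>x. x \<in> \<Omega> \<Longrightarrow> e x $ 3 > 0"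
    and "C2_on m \<Omega>"
    and "\<And>x. x \<in> \<Omega> \<Longrightarrow> mDe x = m x v* jacobian e (at x)"
    and "x0 \<in> \<Omega>"
    and "det (hessian h x0
            + (1 - \<kappa>1 * (e x0 \<bullet> m x0)) *\<^sub>R hessian \<rho> x0
            - \<kappa>1 *\<^sub>R (row_mat (grad \<rho> x0) \<otimes>\<^sub>t row_mat (mDe x0)
                      + row_mat (mDe x0) \<otimes>\<^sub>t row_mat (grad \<rho> x0))
            - (\<kappa>1 * \<rho> x0) *\<^sub>R (jacobian mDe (at x0)
                      - jacobian e (at x0) \<otimes>\<^sub>t jacobian m (at x0))
            + (\<kappa>1 * d x0) *\<^sub>R (jacobian m (at x0) \<otimes>\<^sub>t jacobian m (at x0))) \<noteq> 0"
  shows "\<exists>U V \<phi>. open U \<and> x0 \<in> U \<and> U \<subseteq> \<Omega> \<and>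
           open V \<and> lift3 (Q x0) a \<in> V \<and>
           C1_on \<phi> V \<and> tangential_phase \<sigma>2 V \<phi> \<and>
           (\<forall>x\<in>U. metasurface_refracts k \<kappa>2 V \<phi> (lift3 (Q x) a) (m x) vert)"
proof -

  \<comment> \<open>Unit directions and derivatives of the data\<close>
  note unit_e = assms(11) and P = assms(19) and n = assms(22) and m_eq = assms(25)
    and d = assms(26) and Q = assms(27) and h = assms(30) and mDe = assms(33)
  have \<kappa>1: "\<kappa>1 > 1" and \<kappa>2: "\<kappa>2 > 0"
    using assms(4-7,9,10) by simp_all
  have unit_\<nu>: "norm (\<nu> x) = 1" if "x \<in> \<Omega>" for x
    using n [OF that] by (simp add: unit_normal_toward_def)
  have unit_m: "norm (m x) = 1" and m3: "m x $ 3 > 0" if "x \<in> \<Omega>" for x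
    using that \<kappa>1 unit_e unit_\<nu> assms(24,31)
    by (simp_all add: m_eq norm_snell_refract snell_refract_nth_pos)
  have C1: "C1_on \<rho> \<Omega>" "C1_on e \<Omega>" "C1_on m \<Omega>"
    using assms(1,17,29,32) by (simp_all add: C2_on_imp_C1_on)
  define De where "De x = frechet_derivative e (at x)" for x
  define Dm where "Dm x = frechet_derivative m (at x)" for x
  define D\<rho> where "D\<rho> x = frechet_derivative \<rho> (at x)" for x
  define Dd where "Dd x = frechet_derivative d (at x)" for x
  note De = C2_on_has_derivative [OF assms(29), folded De_def]
    and De' = C2_on_differentiable_derivative [OF assms(1,29), folded De_def]
    and Dm = C2_on_has_derivative [OF assms(32), folded Dm_def]
    and D\<rho> = C2_on_has_derivative [OF assms(17), folded D\<rho>_def]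
    and D\<rho>' = C2_on_differentiable_derivative [OF assms(1,17), folded D\<rho>_def]
  have e_De: "e x \<bullet> De x v = 0" if "x \<in> \<Omega>" for x v
    using inner_derivative_unit_field [OF assms(1) unit_e that De [OF that]] .
  have m_Dm: "m x \<bullet> Dm x v = 0" if "x \<in> \<Omega>" for x v
    using inner_derivative_unit_field [OF assms(1) unit_m that Dm [OF that]] .

  \<comment> \<open>The incidence point \<open>P\<close> and the eikonal identity\<close>
  define DP where "DP x v = lift3 v 0 + (\<rho> x *\<^sub>R De x v + D\<rho> x v *\<^sub>R e x)" for x v
  have C1_P: "C1_on P \<Omega>"
    by (rule C1_on_cong [OF assms(1)], erule P)
       (intro C1_on_add C1_on_scaleR C1 C1_on_bounded_linear [OF bounded_linear_lift3_0] C1_on_ident)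
  have DP: "(P has_derivative DP x) (at x)" if "x \<in> \<Omega>" for x
  proof (rule has_derivative_transform_within_open [OF _ assms(1) that])
    show "((\<lambda>x. lift3 x 0 + \<rho> x *\<^sub>R e x) has_derivative DP x) (at x)"
      unfolding DP_def
      by (rule has_derivative_add [OF
          bounded_linear_imp_has_derivative [OF bounded_linear_lift3_0]
          has_derivative_scaleR [OF D\<rho> [OF that] De [OF that]]])
  qed (simp add: P)
  have eikonal: "\<kappa>1 * (m x \<bullet> DP x v) = hor (e x) \<bullet> v + D\<rho> x v" if "x \<in> \<Omega>" for x v
  proof -
    have "DP x v \<in> tangent_vectors \<sigma>1 (P x)"
      using derivative_in_tangent_vectors [OF assms(1) C1_P _ that DP [OF that]] assms(20) by blast
    then have "\<nu> x \<bullet> DP x v = 0"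
      using n [OF that] by (simp add: unit_normal_toward_def)
    then have "\<kappa>1 * (m x \<bullet> DP x v) = e x \<bullet> DP x v"
      using \<kappa>1 by (simp add: m_eq that snell_refract_tangential)
    \<comment> \<open>In \<open>e \<bullet> DP\<close> the term with \<open>De\<close> vanishes and
      the coefficient of \<open>D\<rho>\<close> is \<open>e \<bullet> e = 1\<close>.\<close>
    also have "\<dots> = hor (e x) \<bullet> v + D\<rho> x v"
      using unit_e [OF that] e_De [OF that]
      by (simp add: DP_def inner_add_right inner_hor dot_square_norm)
    finally show ?thesis .
  qed

  \<comment> \<open>The distance \<open>d\<close> and the point \<open>Q\<close> on the
    metasurface\<close>
  have C1_d: "C1_on d \<Omega>"
  proof (rule C1_on_cong [OF assms(1)], erule d)
    \<comment> \<open>The numerator of \<open>d\<close> is rewritten to fit the rules for sums and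
      scalar multiples.\<close>
    have "C1_on (\<lambda>x. a + (- \<rho> x) *\<^sub>R e x $ 3) \<Omega>"
      by (intro C1_on_add C1_on_const C1_on_scaleR C1
          C1_on_bounded_linear [OF bounded_linear_vec_nth]
          C1_on_bounded_linear [OF bounded_linear_minus [OF bounded_linear_ident]])
    then show "C1_on (\<lambda>x. (a - \<rho> x * e x $ 3) / m x $ 3) \<Omega>"
      using m3 by (intro C1_on_divide C1_on_bounded_linear [OF bounded_linear_vec_nth] C1) force+
  qed
  note Dd = C1_on_has_derivative [OF C1_d, folded Dd_def]
  have C1_Q: "C1_on Q \<Omega>"
  proof (rule C1_on_cong [OF assms(1)])
    show "Q x = hor (P x + d x *\<^sub>R m x)" if "x \<in> \<Omega>" for x
      using hor_lift3 [of "Q x" a] by (simp add: Q that)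
    show "C1_on (\<lambda>x. hor (P x + d x *\<^sub>R m x)) \<Omega>"
      by (intro C1_on_bounded_linear [OF bounded_linear_hor] C1_on_add C1_on_scaleR C1 C1_P C1_d)
  qed
  have DQ: "lift3 (D v) 0 = DP x v + (d x *\<^sub>R Dm x v + Dd x v *\<^sub>R m x)"
    if "x \<in> \<Omega>" "(Q has_derivative D) (at x)" for x D v
  proof -
    \<comment> \<open>Subtracting the constant height \<open>a\<close> turns the lift of
      \<open>Q\<close> into the linear lift at height 0.\<close>
    have "((\<lambda>x. P x + d x *\<^sub>R m x - lift3 0 a) has_derivative
        (\<lambda>v. DP x v + (d x *\<^sub>R Dm x v + Dd x v *\<^sub>R m x) - 0)) (at x)"
      by (intro has_derivative_diff has_derivative_add has_derivative_scaleR has_derivative_const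
          DP Dd Dm that)
    moreover have "P x + d x *\<^sub>R m x - lift3 0 a = lift3 (Q x) 0" if "x \<in> \<Omega>" for x
      by (simp add: vec_eq_iff forall_3 flip: Q [OF that])
    ultimately have "((\<lambda>x. lift3 (Q x) 0) has_derivative
        (\<lambda>v. DP x v + (d x *\<^sub>R Dm x v + Dd x v *\<^sub>R m x) - 0)) (at x)"
      by (rule has_derivative_transform_within_open [OF _ assms(1) that(1)])
    from has_derivative_unique [OF this
        bounded_linear.has_derivative [OF bounded_linear_lift3_0 that(2)]]
    show ?thesis by (simp add: fun_eq_iff)
  qed

  \<comment> \<open>The optical path as a potential along \<open>Q\<close>\<close>
  define \<Psi> where "\<Psi> x = (h x + \<rho> x) / \<kappa>1 + d x" for x
  have pot: "(\<Psi> has_derivative (\<lambda>v. hor (m x) \<bullet> D v)) (at x)"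
    if "x \<in> \<Omega>" "(Q has_derivative D) (at x)" for x D
  proof -
    have "(h has_derivative (\<lambda>v. v \<bullet> hor (e x))) (at x)"
      using h [OF that(1)] by (simp add: gderiv_def)
    then have "(\<Psi> has_derivative (\<lambda>v. (v \<bullet> hor (e x) + D\<rho> x v) / \<kappa>1 + Dd x v)) (at x)"
      unfolding \<Psi>_def using \<kappa>1
      by (auto intro!: derivative_eq_intros D\<rho> Dd that(1))
    moreover have "(v \<bullet> hor (e x) + D\<rho> x v) / \<kappa>1 + Dd x v = hor (m x) \<bullet> D v" for v
    proof -
      have "(v \<bullet> hor (e x) + D\<rho> x v) / \<kappa>1 = m x \<bullet> DP x v"
        using eikonal [OF that(1), of v] \<kappa>1 by (simp add: field_simps inner_commute)
      \<comment> \<open>Of the terms of \<open>DQ\<close> coming from \<open>d\<close> and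
        \<open>m\<close>, the one with \<open>Dm\<close> is orthogonal to \<open>m\<close>, and the
        one with \<open>Dd\<close> is a multiple of the unit vector \<open>m\<close>.\<close>
      moreover have "hor (m x) \<bullet> D v = m x \<bullet> DP x v + Dd x v"
        unfolding inner_hor DQ [OF that]
        using m_Dm unit_m that(1) by (simp add: inner_add_right dot_square_norm)
      ultimately show ?thesis by simp
    qed
    ultimately show ?thesis by simp
  qed

  \<comment> \<open>The matrix of the hypothesis and injectivity of the derivative of
    \<open>Q\<close>\<close>
  define M where "M = hessian h x0
            + (1 - \<kappa>1 * (e x0 \<bullet> m x0)) *\<^sub>R hessian \<rho> x0
            - \<kappa>1 *\<^sub>R (row_mat (grad \<rho> x0) \<otimes>\<^sub>t row_mat (mDe x0)
                      + row_mat (mDe x0) \<otimes>\<^sub>t row_mat (grad \<rho> x0))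
            - (\<kappa>1 * \<rho> x0) *\<^sub>R (jacobian mDe (at x0)
                      - jacobian e (at x0) \<otimes>\<^sub>t jacobian m (at x0))
            + (\<kappa>1 * d x0) *\<^sub>R (jacobian m (at x0) \<otimes>\<^sub>t jacobian m (at x0))"
  note x0 = assms(34)
  have mDe_inner: "mDe x \<bullet> v = m x \<bullet> De x v" if "x \<in> \<Omega>" for x v
    by (simp add: mDe that dot_lmul_matrix jacobian_mult_vec [OF De])
  \<comment> \<open>Pairing \<open>m\<close> with \<open>De\<close> preserves differentiability, so
    \<open>jacobian mDe\<close> at \<open>x0\<close> represents a genuine derivative
    \<open>E\<close>.\<close>
  have "mDe differentiable (at x0)"
  proof (rule differentiable_of_inner_on [OF assms(1) x0], erule mDe_inner)
    fix v
    obtain G where "((\<lambda>x. De x v) has_derivative G) (at x0)"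
      using De' [OF x0] unfolding differentiable_def by blast
    from has_derivative_inner [OF Dm [OF x0] this]
    show "(\<lambda>x. m x \<bullet> De x v) differentiable (at x0)"
      unfolding differentiable_def by blast
  qed
  then obtain E where E: "(mDe has_derivative E) (at x0)"
    unfolding differentiable_def by blast
  have grad_\<rho>: "grad \<rho> x \<bullet> v = D\<rho> x v" if "x \<in> \<Omega>" for x v
    by (rule inner_grad [OF D\<rho> [OF that]])
  have "grad \<rho> differentiable (at x0)"
    by (rule differentiable_of_inner_on [OF assms(1) x0], erule grad_\<rho>) (rule D\<rho>' [OF x0])
  then obtain G where G: "(grad \<rho> has_derivative G) (at x0)"
    unfolding differentiable_def by blast
  have D_hor_e: "((\<lambda>x. hor (e x)) has_derivative (\<lambda>w. hor (De x0 w))) (at x0)"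
    by (rule bounded_linear.has_derivative [OF bounded_linear_hor De [OF x0]])
  \<comment> \<open>Since \<open>grad h\<close> is the horizontal part of \<open>e\<close>, the
    Hessian of \<open>h\<close> acts as \<open>hor\<close> after \<open>De\<close>.\<close>
  have "grad h x = hor (e x)" if "x \<in> \<Omega>" for x
    using h [OF that] by (intro grad_eqI) (simp add: gderiv_def inner_commute)
  then have D_grad_h: "(grad h has_derivative (\<lambda>w. hor (De x0 w))) (at x0)"
    by (intro has_derivative_transform_within_open [OF D_hor_e assms(1) x0]) simp

  \<comment> \<open>The eikonal identity for fixed \<open>v\<close>, differentiated in direction
    \<open>w\<close>. Writing \<open>m \<bullet> De v\<close> as \<open>mDe \<bullet> v\<close> puts
    the second derivatives of \<open>e\<close> into \<open>E\<close>, as in the hypothesis.\<close>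
  have diff_eikonal: "\<kappa>1 * (v \<bullet> hor (Dm x0 w) + (grad \<rho> x0 \<bullet> v) * (m x0 \<bullet> De x0 w + Dm x0 w \<bullet> e x0)
      + (G w \<bullet> v) * (m x0 \<bullet> e x0) + \<rho> x0 * (E w \<bullet> v) + D\<rho> x0 w * (mDe x0 \<bullet> v))
      = hor (De x0 w) \<bullet> v + G w \<bullet> v" for v w
  proof -
    have "((\<lambda>x. \<kappa>1 * (v \<bullet> hor (m x) + (grad \<rho> x \<bullet> v) * (m x \<bullet> e x) + \<rho> x * (mDe x \<bullet> v)))
        has_derivative (\<lambda>w. \<kappa>1 * (v \<bullet> hor (Dm x0 w) + (grad \<rho> x0 \<bullet> v) * (m x0 \<bullet> De x0 w + Dm x0 w \<bullet> e x0)
      + (G w \<bullet> v) * (m x0 \<bullet> e x0) + \<rho> x0 * (E w \<bullet> v) + D\<rho> x0 w * (mDe x0 \<bullet> v)))) (at x0)"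
      by (auto intro!: derivative_eq_intros G E De Dm D\<rho> x0
          bounded_linear.has_derivative [OF bounded_linear_hor])
    moreover have "\<kappa>1 * (v \<bullet> hor (m x) + (grad \<rho> x \<bullet> v) * (m x \<bullet> e x) + \<rho> x * (mDe x \<bullet> v))
        = hor (e x) \<bullet> v + grad \<rho> x \<bullet> v" if "x \<in> \<Omega>" for x
      using eikonal [OF that, of v]
      by (simp add: DP_def inner_add_right inner_hor inner_commute [of v] grad_\<rho> mDe_inner
          that add.commute add.left_commute)
    ultimately have "((\<lambda>x. hor (e x) \<bullet> v + grad \<rho> x \<bullet> v) has_derivative
        (\<lambda>w. \<kappa>1 * (v \<bullet> hor (Dm x0 w) + (grad \<rho> x0 \<bullet> v) * (m x0 \<bullet> De x0 w + Dm x0 w \<bullet> e x0)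
      + (G w \<bullet> v) * (m x0 \<bullet> e x0) + \<rho> x0 * (E w \<bullet> v) + D\<rho> x0 w * (mDe x0 \<bullet> v)))) (at x0)"
      by (rule has_derivative_transform_within_open [OF _ assms(1) x0])
    moreover have "((\<lambda>x. hor (e x) \<bullet> v + grad \<rho> x \<bullet> v) has_derivative
        (\<lambda>w. hor (De x0 w) \<bullet> v + G w \<bullet> v)) (at x0)"
      by (intro has_derivative_add has_derivative_inner_left D_hor_e G)
    ultimately show ?thesis
      by (rule has_derivative_unique [THEN fun_cong])
  qed

  have M: "v \<bullet> (M *v w) = \<kappa>1 * (lift3 (D v) 0 \<bullet> Dm x0 w)"
    if "(Q has_derivative D) (at x0)" for D v w
  proof -
    have "v \<bullet> (M *v w) = v \<bullet> hor (De x0 w) + (1 - \<kappa>1 * (e x0 \<bullet> m x0)) * (v \<bullet> G w)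
        - \<kappa>1 * (D\<rho> x0 v * (mDe x0 \<bullet> w) + (mDe x0 \<bullet> v) * D\<rho> x0 w)
        - (\<kappa>1 * \<rho> x0) * (v \<bullet> E w - De x0 v \<bullet> Dm x0 w)
        + (\<kappa>1 * d x0) * (Dm x0 v \<bullet> Dm x0 w)"
      unfolding M_def hessian_def
      by (simp only: matrix_vector_mult_add_rdistrib matrix_vector_mult_diff_rdistrib
          scaleR_matrix_vector_assoc [symmetric] inner_add_right inner_diff_right inner_scaleR_right
          inner_tprod_mult_vec inner_row_mat_mult_vec grad_\<rho> [OF x0]
          jacobian_mult_vec [OF D_grad_h] jacobian_mult_vec [OF G] jacobian_mult_vec [OF E]
          jacobian_mult_vec [OF De [OF x0]] jacobian_mult_vec [OF Dm [OF x0]])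
    also have "\<dots> = \<kappa>1 * (v \<bullet> hor (Dm x0 w) + \<rho> x0 * (De x0 v \<bullet> Dm x0 w)
        + D\<rho> x0 v * (e x0 \<bullet> Dm x0 w) + d x0 * (Dm x0 v \<bullet> Dm x0 w))"
    proof -
      \<comment> \<open>The differentiated identity is solved for the Hessian term of
        \<open>h\<close>. Substituting it cancels every term with \<open>G\<close>, \<open>E\<close>
        or \<open>mDe\<close>, leaving only pairings with \<open>Dm x0 w\<close>.\<close>
      have *: "v \<bullet> hor (De x0 w) = \<kappa>1 * (v \<bullet> hor (Dm x0 w)
          + D\<rho> x0 v * (mDe x0 \<bullet> w + e x0 \<bullet> Dm x0 w) + (v \<bullet> G w) * (e x0 \<bullet> m x0)
          + \<rho> x0 * (v \<bullet> E w) + D\<rho> x0 w * (mDe x0 \<bullet> v)) - v \<bullet> G w"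
        using diff_eikonal [of v w]
        by (simp only: mDe_inner [OF x0] grad_\<rho> [OF x0] inner_commute [of "hor (De x0 w)" v]
            inner_commute [of "G w" v] inner_commute [of "E w" v] inner_commute [of "m x0" "e x0"]
            inner_commute [of "Dm x0 w" "e x0"] eq_diff_eq)
      show ?thesis unfolding * by (simp add: algebra_simps)
    qed
    \<comment> \<open>The remaining vectors add up to the lifted \<open>D v\<close> except for its
      multiple of \<open>m\<close>, which is orthogonal to \<open>Dm x0 w\<close>.\<close>
    also have "\<dots> = \<kappa>1 * (lift3 (D v) 0 \<bullet> Dm x0 w)"
      unfolding DQ [OF x0 that] DP_def
      using m_Dm [OF x0, of w]
      by (simp add: inner_add_left inner_hor inner_commute [of v] inner_commute [of "lift3 _ _"])
    finally show ?thesis .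
  qed
  have inj_DQ: "inj D" if D: "(Q has_derivative D) (at x0)" for D
  proof -
    have "v = 0" if "D v = 0" for v
    proof -
      have "lift3 (D v) 0 = 0" using that by (simp add: vec_eq_iff forall_3)
      then have *: "v \<bullet> (M *v w) = 0" for w by (simp add: M [OF D])
      have "invertible M" using assms(35) by (simp add: M_def invertible_det_nz)
      \<comment> \<open>A kernel vector \<open>v\<close> of \<open>D\<close> pairs to zero with the
        whole range of \<open>M\<close>; choosing \<open>w = B *v v\<close> gives
        \<open>v \<bullet> v = 0\<close>.\<close>
      then obtain B where "M ** B = mat 1" unfolding invertible_def by blast
      then have "M *v (B *v v) = v" by (simp add: matrix_vector_mul_assoc)
      with * [of "B *v v"] show ?thesis by simp
    qed
    then show ?thesis
      using linear_injective_0 has_derivative_linear [OF D] by blast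
  qed

  \<comment> \<open>Construction of the lens near \<open>x0\<close>\<close>
  have "continuous_on \<Omega> (\<lambda>x. hor (m x))"
    by (rule bounded_linear.continuous_on [OF bounded_linear_hor C1_on_imp_continuous_on [OF C1(3)]])
  \<comment> \<open>The field is \<open>F = hor \<circ> m\<close>. The bound height \<open>a\<close>
    in the result is arbitrary, because the phase is constant along verticals; it is then taken to
    be the height of the metasurface.\<close>
  from phase_of_potential [OF assms(1) x0 C1_Q this inj_DQ pot, of k]
  obtain U V \<phi> where *: "open U" "x0 \<in> U" "U \<subseteq> \<Omega>" "open V" "C1_on \<phi> V"
    "\<forall>x\<in>U. \<forall>a. lift3 (Q x) a \<in> V \<and> grad \<phi> (lift3 (Q x) a) = k *\<^sub>R lift3 (hor (m x)) 0"
    "\<forall>p\<in>V. grad \<phi> p $ 3 = 0" .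
  have "tangential_phase \<sigma>2 V \<phi>"
    unfolding tangential_phase_def using *(7) by (simp add: inner_vert)
  moreover have "lift3 (Q x0) a \<in> V" using *(2,6) by simp
  moreover have "\<forall>x\<in>U. metasurface_refracts k \<kappa>2 V \<phi> (lift3 (Q x) a) (m x) vert"
    using \<kappa>2 assms(8) *(6) by (simp add: vertical_refraction_of_grad)
  ultimately show ?thesis using *(1-5) by (intro exI conjI)
qed

end
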